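(* Let $0<\nu\le1$, $\lambda>0$, and let $N_\nu(t)$ be the fractional linear birth process with rates $\lambda k$ and $n_0\ge1$ initial individuals. Then for all $t>0$ and $k\ge0$, $$\Pr\{N_\nu(t)=k+n_0\mid N_\nu(0)=n_0\}=\binom{n_0+k-1}{k}\sum_{r=0}^{k}\binom{k}{r}(-1)^rE_{\nu,1}\bigl(-(n_0+r)\lambda t^\nu\bigr).$$ Consequently, as $t\to0^+$, $$\Pr\{N_\nu(t)=n_0+1\mid N_\nu(0)=n_0\}\sim\frac{\lambda n_0\,t^\nu}{\Gamma(\nu+1)}.$$
   Context: $E_{\nu,1}(x)=\sum_{h=0}^\infty\frac{x^h}{\Gamma(\nu h+1)}$ is the Mittag-Leffler function. The law of the fractional linear birth process with $n_0$ initial individuals is $$\Pr\{N_\nu(t)=k+n_0\mid N_\nu(0)=n_0\}=\binom{n_0+k-1}{k}\int_0^\infty e^{-\lambda zn_0}(1-e^{-\lambda z})^k\,\Pr\{T_{2\nu}(t)\in\mathrm{d}z\},\qquad k\ge0,$$ i.e. the law of a classical linear birth (Yule--Furry) process with $n_0$ progenitors at an independent random time $T_{2\nu}(t)\ge0$. The law of $T_{2\nu}(t)$ has density $2u_{2\nu}(z,t)$ on $z>0$, where $u_{2\nu}$ is the fundamental solution of $\frac{\partial^{2\nu}u}{\partial t^{2\nu}}=\frac{\partial^2u}{\partial z^2}$ (Dzherbashyan--Caputo time derivative), $u(z,0)=\delta(z)$, with also $u_t(z,0)=0$ if $1/2<\nu\le1$; equivalently its density $f_{T_{2\nu}}$ satisfies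 $\int_0^\infty e^{-\mu t}f_{T_{2\nu}}(z,t)\,\mathrm{d}t=\mu^{\nu-1}e^{-z\mu^\nu}$ for $z>0$, $\mu>0$ (for $\nu=1$, $T_2(t)=t$ almost surely). *)

theory Defs
  imports "HOL-Probability.Probability" "HOL-Library.Landau_Symbols"
begin

definition mittag_leffler :: "real \<Rightarrow> real \<Rightarrow> real \<Rightarrow> real" where
  "mittag_leffler \<nu> \<beta> x = (\<Sum>h. x ^ h / Gamma (\<nu> * real h + \<beta>))"

(* f z t stands for 2 u(z,t) on z > 0, t > 0, where u is the fundamental solution of the
   time-fractional diffusion equation of order 2 nu; it is characterized by its Laplace
   transform in t.  A Laplace transform determines f z only for almost every t; the
   fundamental solution is the version that is continuous in t > 0, and continuity is what
   fixes the law at every single t.  Values of f outside z > 0, t > 0 are irrelevant. *)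
definition fractional_time_density :: "real \<Rightarrow> (real \<Rightarrow> real \<Rightarrow> real) \<Rightarrow> bool" where
  "fractional_time_density \<nu> f \<longleftrightarrow>
     (\<forall>z>0. \<forall>t>0. f z t \<ge> 0) \<and>
     (\<forall>t>0. set_borel_measurable lborel {0<..} (\<lambda>z. f z t)) \<and>
     (\<forall>z>0. continuous_on {0<..} (f z)) \<and>
     (\<forall>z>0. \<forall>\<mu>>0. (LBINT t:{0<..}. exp (- \<mu> * t) * f z t)
                       = \<mu> powr (\<nu> - 1) * exp (- z * \<mu> powr \<nu>))"

(* T t is the law of the random time with index 2 nu at the instant t > 0.  For nu = 1 the
   law has no density: the random time is t almost surely. *)
definition fractional_time_law :: "real \<Rightarrow> (real \<Rightarrow> real measure) \<Rightarrow> bool" where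
  "fractional_time_law \<nu> T \<longleftrightarrow>
     (if \<nu> = 1 then \<forall>t>0. T t = return borel t
      else (\<forall>t>0. prob_space (T t)) \<and>
           (\<exists>f. fractional_time_density \<nu> f \<and>
                (\<forall>t>0. T t = density lborel (\<lambda>z. indicator {0<..} z * ennreal (f z t)))))"

definition fractional_linear_birth_process ::
    "real \<Rightarrow> real \<Rightarrow> nat \<Rightarrow> 'a measure \<Rightarrow> (real \<Rightarrow> 'a \<Rightarrow> nat) \<Rightarrow> bool" where
  "fractional_linear_birth_process \<nu> lam n0 M N \<longleftrightarrow>
     prob_space M \<and>
     (\<forall>t\<ge>0. N t \<in> measurable M (count_space UNIV)) \<and>
     (AE \<omega> in M. N 0 \<omega> = n0) \<and>
     (\<exists>T. fractional_time_law \<nu> T \<and>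
        (\<forall>t>0. \<forall>k.
           \<P>(\<omega> in M. N t \<omega> = k + n0 \<bar> N 0 \<omega> = n0) =
             real ((n0 + k - 1) choose k) *
             (LINT z:{0..}|T t. exp (- lam * z * real n0) * (1 - exp (- lam * z)) ^ k)))"

end

theory Submission
  imports Defs
begin

text \<open>The state probability is an average over the random time \<open>z\<close> of the Yule probability
\<open>exp (- lam * z * n0) * (1 - exp (- lam * z)) ^ k\<close>. By the binomial theorem this is a signed combination of
the exponentials \<open>exp (- s * z)\<close> with \<open>s = (n0 + r) * lam\<close>, so everything reduces to one identity: the random
time at instant \<open>t\<close> has Laplace transform \<open>mittag_leffler \<nu> 1 (- s * t powr \<nu>)\<close> at every \<open>s > 0\<close>
(lemma \<open>laplace_fractional_time_law\<close>).

For \<open>\<nu> < 1\<close> the densities are known only through their Laplace transform in \<open>t\<close>. Applying Tonelli's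
theorem to the double transform in \<open>z\<close> and \<open>t\<close> gives \<open>\<mu> powr (\<nu> - 1) / (\<mu> powr \<nu> + s)\<close>
(lemma \<open>double_laplace_time_density\<close>), and the termwise transform of the Mittag-Leffler series is a geometric
series with the same sum (lemma \<open>laplace_mittag_leffler\<close>). Equal transforms give equality for almost every \<open>t\<close>
only, while the claim concerns each \<open>t\<close>. The gap is closed by continuity: the densities are pointwise
continuous in \<open>t\<close> and all have mass 1, so Scheffe's lemma makes their transform in \<open>z\<close> continuous in \<open>t\<close>
(lemma \<open>continuous_on_density_integral\<close>), and for continuous functions Lerch's theorem
(lemma \<open>laplace_zero_imp_zero\<close>) yields equality everywhere.

The asymptotic claim is the case \<open>k = 1\<close>, a difference of two Mittag-Leffler functions expanded to first
order at 0.\<close>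

section \<open>The Mittag-Leffler function and its Laplace transform\<close>

lemma has_bochner_integral_powr_exp:
  fixes a \<mu> :: real
  assumes a: "a > 0" and \<mu>: "\<mu> > 0"
  shows "has_bochner_integral lborel
           (\<lambda>t. indicator {0<..} t * (t powr (a - 1) * exp (- \<mu> * t))) (Gamma a / \<mu> powr a)"
proof (rule has_bochner_integral_nn_integral)
  let ?g = "\<lambda>t. ennreal (indicator {0<..} t * (t powr (a - 1) * exp (- \<mu> * t)))"
  have pw: "\<mu> powr a = \<mu> * \<mu> powr (a - 1)"
    using \<mu> powr_add[of \<mu> 1 "a - 1"] by simp
  have "ennreal (Gamma a) = (\<integral>\<^sup>+t. ennreal (indicator {0..} t * t powr (a - 1) / exp t) \<partial>lborel)"
    using Gamma_conv_nn_integral_real[OF a] by simp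
  also have "\<dots> = ennreal \<bar>\<mu>\<bar> * (\<integral>\<^sup>+t. ennreal (indicator {0..} (0 + \<mu> * t) * (0 + \<mu> * t) powr (a - 1) / exp (0 + \<mu> * t)) \<partial>lborel)"
    using \<mu> by (intro nn_integral_real_affine) auto
  also have "(\<integral>\<^sup>+t. ennreal (indicator {0..} (0 + \<mu> * t) * (0 + \<mu> * t) powr (a - 1) / exp (0 + \<mu> * t)) \<partial>lborel)
      = (\<integral>\<^sup>+t. ennreal (\<mu> powr (a - 1)) * ?g t \<partial>lborel)"
  proof (intro nn_integral_cong_AE)
    show "AE t in lborel. ennreal (indicator {0..} (0 + \<mu> * t) * (0 + \<mu> * t) powr (a - 1) / exp (0 + \<mu> * t))
        = ennreal (\<mu> powr (a - 1)) * ?g t"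
      using AE_lborel_singleton[of 0]
    proof eventually_elim
      case (elim t)
      show ?case using \<mu> elim
        by (auto simp: indicator_def powr_mult exp_minus divide_simps zero_le_mult_iff
                 ennreal_mult[symmetric] simp flip: ennreal_mult')
    qed
  qed
  also have "\<dots> = ennreal (\<mu> powr (a - 1)) * (\<integral>\<^sup>+t. ?g t \<partial>lborel)"
    by (intro nn_integral_cmult) auto
  finally have "ennreal (Gamma a) = ennreal (\<mu> powr a) * (\<integral>\<^sup>+t. ?g t \<partial>lborel)"
    using \<mu> pw by (simp add: ennreal_mult' mult.assoc)
  hence "ennreal (1 / \<mu> powr a) * ennreal (Gamma a)
     = (ennreal (1 / \<mu> powr a) * ennreal (\<mu> powr a)) * (\<integral>\<^sup>+t. ?g t \<partial>lborel)"
    by (simp add: mult.assoc)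
  moreover have "ennreal (1 / \<mu> powr a) * ennreal (\<mu> powr a) = 1"
    using \<mu> by (simp flip: ennreal_mult)
  moreover have "ennreal (1 / \<mu> powr a) * ennreal (Gamma a) = ennreal (Gamma a / \<mu> powr a)"
    by (simp flip: ennreal_mult')
  ultimately show "(\<integral>\<^sup>+t. ?g t \<partial>lborel) = ennreal (Gamma a / \<mu> powr a)"
    by simp
qed (use a in \<open>auto intro!: divide_nonneg_nonneg less_imp_le[OF Gamma_real_pos]\<close>)

text \<open>Keeping only the window \<open>{R..R+1}\<close> of Euler's integral is crude, but since \<open>R\<close> is free it already
shows that \<open>Gamma\<close> outgrows every geometric sequence, which is all that the Mittag-Leffler series
needs.\<close>

lemma Gamma_ge_powr:
  fixes a R :: real
  assumes a: "a \<ge> 0" and R: "R > 0"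
  shows "R powr a * exp (- (R + 1)) \<le> Gamma (a + 1)"
proof -
  have "ennreal (R powr a * exp (- (R + 1))) =
          (\<integral>\<^sup>+t. ennreal (R powr a * exp (- (R + 1))) * indicator {R..R+1} t \<partial>lborel)"
    by (subst nn_integral_cmult_indicator) auto
  also have "\<dots> \<le> (\<integral>\<^sup>+t. ennreal (indicator {0..} t * t powr (a + 1 - 1) / exp t) \<partial>lborel)"
  proof (intro nn_integral_mono)
    fix t :: real
    show "ennreal (R powr a * exp (- (R + 1))) * indicator {R..R+1} t
            \<le> ennreal (indicator {0..} t * t powr (a + 1 - 1) / exp t)"
    proof (cases "t \<in> {R..R+1}")
      case True
      have "R powr a * exp (- (R + 1)) \<le> t powr a * exp (- t)"
        using True a R by (intro mult_mono powr_mono2) auto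
      with True R show ?thesis by (auto simp: exp_minus field_simps)
    qed auto
  qed
  also have "\<dots> = ennreal (Gamma (a + 1))"
    using Gamma_conv_nn_integral_real[of "a + 1"] a by simp
  finally show ?thesis
    using a by (simp add: less_imp_le[OF Gamma_real_pos] ennreal_le_iff)
qed

lemma summable_mittag_leffler:
  fixes \<nu> x :: real
  assumes \<nu>: "\<nu> > 0"
  shows "summable (\<lambda>h. x ^ h / Gamma (\<nu> * real h + 1))"
proof -
  \<comment> \<open>With this choice \<open>R powr (\<nu> * h)\<close> is an exact \<open>h\<close>-th power whose base exceeds \<open>2 * \<bar>x\<bar>\<close>.\<close>
  define R where "R = (2 * \<bar>x\<bar> + 1) powr (1 / \<nu>)"
  have R: "R > 0" "R powr \<nu> = 2 * \<bar>x\<bar> + 1"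
    using \<nu> by (auto simp: R_def powr_powr)
  have Rh: "R powr (\<nu> * real h) = (2 * \<bar>x\<bar> + 1) ^ h" for h
    using R by (simp add: powr_powr[symmetric] powr_realpow)
  show ?thesis
  proof (rule summable_comparison_test')
    show "summable (\<lambda>h. exp (R + 1) * (1 / 2) ^ h)"
      by (intro summable_mult summable_geometric) auto
  next
    fix h :: nat
    have G: "(2 * \<bar>x\<bar> + 1) ^ h * exp (- (R + 1)) \<le> Gamma (\<nu> * real h + 1)"
      using Gamma_ge_powr[of "\<nu> * real h" R] \<nu> R Rh by simp
    have pos: "0 < (2 * \<bar>x\<bar> + 1) ^ h * exp (- (R + 1))" by simp
    have Gpos: "0 < Gamma (\<nu> * real h + 1)" using pos G by (rule less_le_trans)
    hence "norm (x ^ h / Gamma (\<nu> * real h + 1)) = \<bar>x\<bar> ^ h / Gamma (\<nu> * real h + 1)"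
      by (simp add: power_abs)
    also have "\<dots> \<le> \<bar>x\<bar> ^ h / ((2 * \<bar>x\<bar> + 1) ^ h * exp (- (R + 1)))"
      using G pos Gpos by (intro divide_left_mono mult_pos_pos) auto
    also have "\<dots> = exp (R + 1) * (\<bar>x\<bar> / (2 * \<bar>x\<bar> + 1)) ^ h"
      unfolding exp_minus power_divide by (simp add: divide_simps)
    also have "\<dots> \<le> exp (R + 1) * (1 / 2) ^ h"
      by (intro mult_left_mono power_mono) (auto simp: field_simps)
    finally show "norm (x ^ h / Gamma (\<nu> * real h + 1)) \<le> exp (R + 1) * (1 / 2) ^ h" .
  qed
qed

lemma mittag_leffler_powser:
  "mittag_leffler \<nu> 1 = (\<lambda>x. \<Sum>h. (1 / Gamma (\<nu> * real h + 1)) * x ^ h)"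
  by (simp add: mittag_leffler_def fun_eq_iff)

lemma isCont_mittag_leffler:
  assumes "\<nu> > 0"
  shows "isCont (mittag_leffler \<nu> 1) x"
  unfolding mittag_leffler_powser
  using summable_mittag_leffler[OF assms] by (intro isCont_powser_converges_everywhere) simp

lemma mittag_leffler_deriv_0:
  assumes "\<nu> > 0"
  shows "(mittag_leffler \<nu> 1 has_real_derivative 1 / Gamma (\<nu> + 1)) (at 0)"
proof -
  let ?c = "\<lambda>h. 1 / Gamma (\<nu> * real h + 1)"
  have "(mittag_leffler \<nu> 1 has_real_derivative (\<Sum>n. diffs ?c n * 0 ^ n)) (at 0)"
    unfolding mittag_leffler_powser
    using summable_mittag_leffler[OF assms] by (intro termdiffs_strong_converges_everywhere) simp
  also have "(\<Sum>n. diffs ?c n * 0 ^ n) = diffs ?c 0"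
    by (rule powser_zero)
  finally show ?thesis by (simp add: diffs_def)
qed

lemma mittag_leffler_1_1: "mittag_leffler 1 1 x = exp x"
proof -
  have "Gamma (real h + 1) = fact h" for h
    using Gamma_fact[of h, where 'a=real] by (simp add: add.commute)
  thus ?thesis
    by (simp add: mittag_leffler_def exp_def field_simps)
qed

text \<open>Termwise the \<open>h\<close>-th power \<open>t powr (\<nu> * h)\<close> is transformed into \<open>Gamma (\<nu> * h + 1)\<close> times a power of \<open>\<mu>\<close>, so the
coefficients cancel and a geometric series of ratio \<open>c / \<mu> powr \<nu>\<close> is left. The condition on \<open>c\<close> makes it
converge absolutely, which also justifies exchanging sum and integral.\<close>

lemma laplace_mittag_leffler:
  fixes \<nu> c \<mu> :: real
  assumes \<nu>: "\<nu> > 0" and \<mu>: "\<mu> > 0" and c: "\<bar>c\<bar> < \<mu> powr \<nu>"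
  shows "has_bochner_integral lborel
           (\<lambda>t. indicator {0<..} t * (exp (- \<mu> * t) * mittag_leffler \<nu> 1 (c * t powr \<nu>)))
           (\<mu> powr (\<nu> - 1) / (\<mu> powr \<nu> - c))"
proof -
  define F where "F d h t = indicator {0<..} t * (t powr (\<nu> * real h) * exp (- \<mu> * t)) * (d ^ h / Gamma (\<nu> * real h + 1))"
    for d t :: real and h :: nat
  have Gpos: "Gamma (\<nu> * real h + 1) > 0" for h
    using \<nu> by (intro Gamma_real_pos) (auto intro: add_nonneg_pos)
  have F: "has_bochner_integral lborel (F d h) ((1 / \<mu>) * (d / \<mu> powr \<nu>) ^ h)" for d h
  proof -
    have "has_bochner_integral lborel (\<lambda>t. indicator {0<..} t * (t powr (\<nu> * real h + 1 - 1) * exp (- \<mu> * t)) * (d ^ h / Gamma (\<nu> * real h + 1)))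
       (Gamma (\<nu> * real h + 1) / \<mu> powr (\<nu> * real h + 1) * (d ^ h / Gamma (\<nu> * real h + 1)))"
      using \<nu> \<mu> by (intro has_bochner_integral_mult_left has_bochner_integral_powr_exp)
        (auto intro: add_nonneg_pos)
    also have "(Gamma (\<nu> * real h + 1) / \<mu> powr (\<nu> * real h + 1) * (d ^ h / Gamma (\<nu> * real h + 1)))
       = (1 / \<mu>) * (d / \<mu> powr \<nu>) ^ h"
      using Gpos[of h] \<mu>
      by (simp add: powr_add powr_powr[symmetric] powr_realpow power_divide)
    finally show ?thesis by (simp add: F_def[abs_def])
  qed
  have Fs: "(\<lambda>h. F d h t) sums (indicator {0<..} t * (exp (- \<mu> * t) * mittag_leffler \<nu> 1 (d * t powr \<nu>)))" for d t
  proof (cases "t > 0")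
    case True
    have "(\<lambda>h. (d * t powr \<nu>) ^ h / Gamma (\<nu> * real h + 1)) sums mittag_leffler \<nu> 1 (d * t powr \<nu>)"
      unfolding mittag_leffler_def by (rule summable_sums[OF summable_mittag_leffler[OF \<nu>]])
    from sums_mult[OF this, of "exp (- \<mu> * t)"] True show ?thesis
      by (simp add: F_def powr_powr[symmetric] powr_realpow power_mult_distrib mult_ac)
  qed (simp add: F_def)
  \<comment> \<open>Replacing \<open>c\<close> by its absolute value turns the norm of each term into a term of the same family.\<close>
  have normF: "norm (F c h t) = F \<bar>c\<bar> h t" for h t
    using Gpos[of h] by (simp add: F_def abs_mult power_abs)
  have geo: "norm (c / \<mu> powr \<nu>) < 1" "norm (\<bar>c\<bar> / \<mu> powr \<nu>) < 1"
    using c \<mu> by (auto simp: field_simps)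
  have int: "\<And>h. integrable lborel (F c h)"
    using F by (auto simp: has_bochner_integral_iff)
  have AE: "AE t in lborel. summable (\<lambda>h. norm (F c h t))"
    unfolding normF using Fs[of "\<bar>c\<bar>"] by (intro AE_I2) (rule sums_summable)
  have sm: "summable (\<lambda>h. \<integral>t. norm (F c h t) \<partial>lborel)"
    using has_bochner_integral_integral_eq[OF F[of "\<bar>c\<bar>"]] summable_geometric[OF geo(2)]
    unfolding normF by (simp add: summable_divide)
  have eq: "(\<Sum>h. F c h t) = indicator {0<..} t * (exp (- \<mu> * t) * mittag_leffler \<nu> 1 (c * t powr \<nu>))" for t
    using Fs sums_unique by metis
  have "(\<Sum>h. integral\<^sup>L lborel (F c h)) = (\<Sum>h. (1 / \<mu>) * (c / \<mu> powr \<nu>) ^ h)"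
    using F[of c] by (simp add: has_bochner_integral_iff)
  also have "\<dots> = (1 / \<mu>) * (1 / (1 - c / \<mu> powr \<nu>))"
    using suminf_geometric[OF geo(1)] suminf_mult[OF summable_geometric[OF geo(1)]] by metis
  also have "\<dots> = \<mu> powr (\<nu> - 1) / (\<mu> powr \<nu> - c)"
    using \<mu> c by (simp add: powr_diff field_simps)
  finally show ?thesis
    using integrable_suminf[OF int AE sm] integral_suminf[OF int AE sm]
    by (simp add: eq has_bochner_integral_iff)
qed

section \<open>Uniqueness of Laplace transforms\<close>

text \<open>Lerch's uniqueness theorem for continuous functions. Substituting \<open>x = exp (- t)\<close>, the hypothesis says
that \<open>\<phi>\<close> annihilates all monomials on \<open>{0..1}\<close>, hence by Weierstrass all continuous functions of
\<open>exp (- t)\<close>; a bump supported where \<open>\<phi>\<close> keeps its sign then forces \<open>\<phi>\<close> to vanish. Continuity makes the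
conclusion hold at every point and not just almost everywhere.\<close>

lemma laplace_zero_imp_zero:
  fixes \<phi> :: "real \<Rightarrow> real"
  assumes cont: "continuous_on {0<..} \<phi>"
    and int: "set_integrable lborel {0<..} \<phi>"
    and zero: "\<And>n::nat. (LBINT t:{0<..}. exp (- t) ^ n * \<phi> t) = 0"
    and t: "t > 0"
  shows "\<phi> t = 0"
proof -
  define \<psi> where "\<psi> t = indicator {0<..} t * \<phi> t" for t
  have \<psi>: "integrable lborel \<psi>"
    using int by (simp add: set_integrable_def \<psi>_def[abs_def])
  have [measurable]: "\<psi> \<in> borel_measurable borel"
    using \<psi> by auto
  have bnd: "integrable lborel (\<lambda>t. q (exp (- t)) * \<psi> t)"
    if q: "continuous_on UNIV q" for q :: "real \<Rightarrow> real"
  proof -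
    have [measurable]: "q \<in> borel_measurable borel"
      using q by (rule borel_measurable_continuous_onI)
    have "compact (q ` {0..1})"
      by (intro compact_continuous_image continuous_on_subset[OF q]) auto
    then obtain B where B: "\<And>x. x \<in> {0..1} \<Longrightarrow> \<bar>q x\<bar> \<le> B"
      by (fastforce dest!: compact_imp_bounded simp: bounded_iff)
    show ?thesis
    proof (rule Bochner_Integration.integrable_bound)
      show "integrable lborel (\<lambda>t. B * \<psi> t)" using \<psi> by simp
      show "AE t in lborel. norm (q (exp (- t)) * \<psi> t) \<le> norm (B * \<psi> t)"
      proof (rule AE_I2)
        fix t :: real
        show "norm (q (exp (- t)) * \<psi> t) \<le> norm (B * \<psi> t)"
        proof (cases "t > 0")
          case True
          hence "\<bar>q (exp (- t))\<bar> \<le> \<bar>B\<bar>"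
            using B[of "exp (- t)"] by auto
          thus ?thesis by (simp add: abs_mult mult_right_mono)
        qed (simp add: \<psi>_def)
      qed
    qed measurable
  qed
  have poly: "(\<integral>t. p (exp (- t)) * \<psi> t \<partial>lborel) = 0" if p: "real_polynomial_function p" for p :: "real \<Rightarrow> real"
  proof -
    obtain a n where p_eq: "p = (\<lambda>x. \<Sum>i\<le>n. a i * x ^ i)"
      using p by (auto simp: real_polynomial_function_iff_sum)
    have "(\<integral>t. p (exp (- t)) * \<psi> t \<partial>lborel) = (\<integral>t. (\<Sum>i\<le>n. a i * (exp (- t) ^ i * \<psi> t)) \<partial>lborel)"
      by (simp add: p_eq sum_distrib_right mult.assoc)
    also have "\<dots> = (\<Sum>i\<le>n. a i * (\<integral>t. exp (- t) ^ i * \<psi> t \<partial>lborel))"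
      using bnd[OF continuous_on_power[OF continuous_on_id]]
      by (subst Bochner_Integration.integral_sum) auto
    also have "\<dots> = 0"
      using zero by (simp add: set_lebesgue_integral_def \<psi>_def mult_ac)
    finally show ?thesis by simp
  qed
  have all: "(\<integral>t. q (exp (- t)) * \<psi> t \<partial>lborel) = 0" if q: "continuous_on UNIV q" for q :: "real \<Rightarrow> real"
  proof -
    define C where "C = (\<integral>t. \<bar>\<psi> t\<bar> \<partial>lborel)"
    have C: "C \<ge> 0" by (simp add: C_def)
    have "\<bar>\<integral>t. q (exp (- t)) * \<psi> t \<partial>lborel\<bar> \<le> e * C" if e: "e > 0" for e
    proof -
      obtain p where p: "real_polynomial_function p" "\<And>x. x \<in> {0..1} \<Longrightarrow> \<bar>q x - p x\<bar> < e"
        using Stone_Weierstrass_real_polynomial_function[of "{0..1::real}" q e] e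
          continuous_on_subset[OF q] by auto
      have pc: "continuous_on UNIV p"
        using p(1) by (simp add: continuous_on_polymonial_function real_polynomial_function_eq)
      have "(\<integral>t. q (exp (- t)) * \<psi> t \<partial>lborel) = (\<integral>t. q (exp (- t)) * \<psi> t - p (exp (- t)) * \<psi> t \<partial>lborel)"
        using poly[OF p(1)] by (subst Bochner_Integration.integral_diff) (auto intro: bnd q pc)
      also have "\<bar>\<dots>\<bar> \<le> (\<integral>t. \<bar>q (exp (- t)) * \<psi> t - p (exp (- t)) * \<psi> t\<bar> \<partial>lborel)"
        by (rule integral_abs_bound)
      also have "\<dots> \<le> (\<integral>t. e * \<bar>\<psi> t\<bar> \<partial>lborel)"
      proof (rule integral_mono)
        fix t :: real
        show "\<bar>q (exp (- t)) * \<psi> t - p (exp (- t)) * \<psi> t\<bar> \<le> e * \<bar>\<psi> t\<bar>"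
        proof (cases "t > 0")
          case True
          hence "\<bar>q (exp (- t)) - p (exp (- t))\<bar> \<le> e"
            using p(2)[of "exp (- t)"] by auto
          thus ?thesis
            by (simp add: abs_mult mult_right_mono flip: left_diff_distrib)
        qed (simp add: \<psi>_def)
      qed (use \<psi> in \<open>auto intro!: bnd q pc\<close>)
      also have "\<dots> = e * C" by (simp add: C_def)
      finally show ?thesis .
    qed
    hence le: "\<bar>\<integral>t. q (exp (- t)) * \<psi> t \<partial>lborel\<bar> \<le> e * C" if "e > 0" for e
      using that .
    have "\<bar>\<integral>t. q (exp (- t)) * \<psi> t \<partial>lborel\<bar> \<le> 0 + \<delta>" if "\<delta> > 0" for \<delta>
    proof -
      have "\<delta> / (C + 1) * C \<le> \<delta>"
        using that C by (simp add: field_simps)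
      thus ?thesis using le[of "\<delta> / (C + 1)"] that C by simp
    qed
    hence "\<bar>\<integral>t. q (exp (- t)) * \<psi> t \<partial>lborel\<bar> \<le> 0"
      by (rule field_le_epsilon)
    thus ?thesis by simp
  qed
  \<comment> \<open>The factor \<open>\<sigma>\<close> treats both signs of \<open>\<phi> t\<close> at once.\<close>
  have False if s: "\<sigma> * \<phi> t > 0" for \<sigma> :: real
  proof -
    have "((\<lambda>x. \<sigma> * \<phi> x) \<longlongrightarrow> \<sigma> * \<phi> t) (at t)"
      using cont t by (intro tendsto_intros) (auto simp: continuous_on_eq_continuous_at isCont_def)
    hence "eventually (\<lambda>x. \<sigma> * \<phi> x > 0) (at t)"
      using s by (rule order_tendstoD)
    then obtain d where d: "d > 0" "\<And>x. x \<noteq> t \<Longrightarrow> dist x t < d \<Longrightarrow> \<sigma> * \<phi> x > 0"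
      by (auto simp: eventually_at)
    define a where "a = max (t / 2) (t - d)"
    define b where "b = t + d"
    have ab: "0 < a" "a < b" using d t by (auto simp: a_def b_def)
    have pos: "\<sigma> * \<phi> x > 0" if "x \<in> {a<..<b}" for x
      using that s d(2)[of x] by (cases "x = t") (auto simp: a_def b_def dist_real_def)
    \<comment> \<open>In the variable \<open>x = exp (- t)\<close>, a bump supported on the image of \<open>{a<..<b}\<close>, with the sign of \<open>\<phi> t\<close>.\<close>
    define q where "q x = \<sigma> * max 0 ((exp (- a) - x) * (x - exp (- b)))" for x
    have q: "continuous_on UNIV q"
      unfolding q_def by (intro continuous_intros)
    have q0: "q (exp (- x)) = 0" if "x \<notin> {a<..<b}" for x
    proof -
      have "(exp (- a) - exp (- x)) * (exp (- x) - exp (- b)) \<le> 0"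
        using that ab by (cases "x \<le> a") (simp_all add: mult_nonneg_nonpos mult_nonpos_nonneg)
      thus ?thesis by (simp add: q_def)
    qed
    have qpos: "q (exp (- x)) * \<psi> x > 0" if "x \<in> {a<..<b}" for x
    proof -
      have "(exp (- a) - exp (- x)) * (exp (- x) - exp (- b)) > 0"
        using that by (intro mult_pos_pos) auto
      moreover have "\<psi> x = \<phi> x" using that ab by (auto simp: \<psi>_def)
      ultimately show ?thesis
        using mult_pos_pos[OF _ pos[OF that], of "(exp (- a) - exp (- x)) * (exp (- x) - exp (- b))"]
        by (simp add: q_def max_def mult_ac)
    qed
    have nn: "AE x in lborel. 0 \<le> q (exp (- x)) * \<psi> x"
      using q0 qpos by (intro AE_I2) (metis less_imp_le mult_zero_left order_refl)
    have "AE x in lborel. q (exp (- x)) * \<psi> x = 0"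
      using integral_nonneg_eq_0_iff_AE[OF bnd[OF q] nn] all[OF q] by simp
    hence "AE x in lborel. x \<notin> {a<..<b}"
      by eventually_elim (use qpos in force)
    hence "{a<..<b} \<in> null_sets lborel"
      by (subst AE_iff_null_sets) auto
    thus False using ab by (auto simp: null_sets_def)
  qed
  from this[of "\<phi> t"] show ?thesis
    by (metis not_real_square_gt_zero)
qed

section \<open>Families of densities depending continuously on a parameter\<close>

text \<open>A Caratheodory function, measurable in one variable and continuous in the other, is jointly
measurable: it is the limit of the functions obtained by rounding \<open>t\<close> up to a grid of mesh
\<open>1 / Suc n\<close>, and each of those has only countably many distinct sections. Tonelli's theorem for the time
density rests on this.\<close>

lemma borel_measurable_caratheodory:
  fixes f :: "real \<Rightarrow> real \<Rightarrow> real"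
  assumes meas: "\<And>t. t > 0 \<Longrightarrow> (\<lambda>z. indicator A z * f z t) \<in> borel_measurable borel"
    and cont: "\<And>z. z \<in> A \<Longrightarrow> continuous_on {0<..} (f z)"
  shows "(\<lambda>(z, t). indicator A z * indicator {0<..} t * f z t) \<in> borel_measurable (borel \<Otimes>\<^sub>M borel)"
proof -
  \<comment> \<open>Rounding is strictly upwards, so that the grid points stay in the domain \<open>{0<..}\<close>.\<close>
  define d where "d n t = real_of_int (\<lfloor>real (Suc n) * t\<rfloor> + 1) / real (Suc n)" for n t
  define F where "F n p = indicator {0<..} (snd p) * (indicator A (fst p) * f (fst p) (d n (snd p)))"
    for n and p :: "real \<times> real"
  have d_gt: "t < d n t" and d_le: "d n t \<le> t + 1 / real (Suc n)" for n t
    unfolding d_def by (simp_all add: field_simps del: of_nat_Suc) linarith+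
  have [measurable]: "F n \<in> borel_measurable (borel \<Otimes>\<^sub>M borel)" for n
  proof -
    have "(\<lambda>p::real \<times> real. indicator {0<..} (snd p) *
             (indicator {0..} m * (indicator A (fst p) * f (fst p) (real_of_int (m + 1) / real (Suc n)))))
          \<in> borel_measurable (borel \<Otimes>\<^sub>M borel)" for m :: int
    proof (cases "m \<ge> 0")
      case True
      hence "(\<lambda>z. indicator A z * f z (real_of_int (m + 1) / real (Suc n))) \<in> borel_measurable borel"
        by (intro meas) (auto intro!: divide_pos_pos)
      hence "(\<lambda>p::real \<times> real. indicator A (fst p) * f (fst p) (real_of_int (m + 1) / real (Suc n)))
               \<in> borel_measurable (borel \<Otimes>\<^sub>M (borel :: real measure))"
        by (rule measurable_compose[OF measurable_fst])
      moreover have "(\<lambda>p::real \<times> real. indicator {0<..} (snd p) :: real) \<in> borel_measurable ((borel :: real measure) \<Otimes>\<^sub>M (borel :: real measure))"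
        by (intro measurable_compose[OF measurable_snd] borel_measurable_indicator) auto
      ultimately show ?thesis
        by (intro borel_measurable_times[OF _ borel_measurable_times[OF borel_measurable_const]])
    qed auto
    hence "(\<lambda>p::real \<times> real. indicator {0<..} (snd p) *
             (indicator {0..} \<lfloor>real (Suc n) * snd p\<rfloor> * (indicator A (fst p) * f (fst p) (d n (snd p)))))
          \<in> borel_measurable (borel \<Otimes>\<^sub>M borel)"
      unfolding d_def by (rule measurable_compose_countable) measurable
    also have "(\<lambda>p::real \<times> real. indicator {0<..} (snd p) *
             (indicator {0..} \<lfloor>real (Suc n) * snd p\<rfloor> * (indicator A (fst p) * f (fst p) (d n (snd p))))) = F n"
      by (auto simp: F_def fun_eq_iff indicator_def)
    finally show ?thesis .
  qed
  show ?thesis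
  proof (rule borel_measurable_LIMSEQ_real)
    fix p :: "real \<times> real"
    show "(\<lambda>n. F n p) \<longlonglongrightarrow> (case p of (z, t) \<Rightarrow> indicator A z * indicator {0<..} t * f z t)"
    proof (cases "fst p \<in> A \<and> snd p > 0")
      case True
      have "(\<lambda>n. snd p + 1 / real (Suc n)) \<longlonglongrightarrow> snd p + 0"
        by (intro tendsto_intros LIMSEQ_Suc lim_1_over_n)
      hence up: "(\<lambda>n. snd p + 1 / real (Suc n)) \<longlonglongrightarrow> snd p" by simp
      have "(\<lambda>n. d n (snd p)) \<longlonglongrightarrow> snd p"
      proof (rule tendsto_sandwich[OF _ _ tendsto_const up])
        show "\<forall>\<^sub>F n in sequentially. snd p \<le> d n (snd p)"
          by (rule always_eventually) (use d_gt less_imp_le in blast)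
        show "\<forall>\<^sub>F n in sequentially. d n (snd p) \<le> snd p + 1 / real (Suc n)"
          by (rule always_eventually) (use d_le in blast)
      qed
      moreover have "isCont (f (fst p)) (snd p)"
        using True cont[of "fst p"] by (auto simp: continuous_on_eq_continuous_at)
      ultimately have "(\<lambda>n. f (fst p) (d n (snd p))) \<longlonglongrightarrow> f (fst p) (snd p)"
        by (rule isCont_tendsto_compose[OF _ _, rotated])
      thus ?thesis using True by (auto simp: F_def case_prod_unfold)
    qed (auto simp: F_def case_prod_unfold)
  qed auto
qed

text \<open>Pointwise convergence of probability densities to a probability density is convergence in \<open>L\<^sup>1\<close>
(Scheffe), so bounded observables have expectations that are continuous in the parameter. The
constant total mass plays the role that a dominating function has in dominated convergence.\<close>

lemma continuous_on_density_integral: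
  fixes f :: "real \<Rightarrow> real \<Rightarrow> real" and w :: "real \<Rightarrow> real"
  assumes nonneg: "\<And>z t. z \<in> A \<Longrightarrow> t > 0 \<Longrightarrow> f z t \<ge> 0"
    and meas: "\<And>t. t > 0 \<Longrightarrow> (\<lambda>z. indicator A z * f z t) \<in> borel_measurable borel"
    and cont: "\<And>z. z \<in> A \<Longrightarrow> continuous_on {0<..} (f z)"
    and mass: "\<And>t. t > 0 \<Longrightarrow> (\<integral>\<^sup>+z. ennreal (indicator A z * f z t) \<partial>lborel) = 1"
    and w [measurable]: "w \<in> borel_measurable borel"
    and bound: "\<And>z. z \<in> A \<Longrightarrow> \<bar>w z\<bar> \<le> B"
  shows integrable_density_integrand:
      "\<And>t. t > 0 \<Longrightarrow> integrable lborel (\<lambda>z. w z * (indicator A z * f z t))"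
    and "continuous_on {0<..} (\<lambda>t. \<integral>z. w z * (indicator A z * f z t) \<partial>lborel)"
proof -
  define F where "F t z = indicator A z * f z t" for t z
  have F_meas [measurable]: "F t \<in> borel_measurable borel" if "t > 0" for t
    using meas[OF that] by (simp add: F_def[abs_def])
  have F_nonneg: "F t z \<ge> 0" if "t > 0" for t z
    using nonneg that by (simp add: F_def indicator_def)
  have F_mass: "(\<integral>\<^sup>+z. norm (F t z) \<partial>lborel) = 1" if "t > 0" for t
    using mass[OF that] F_nonneg[OF that] by (simp add: F_def)
  have F_int: "integrable lborel (F t)" if "t > 0" for t
    by (rule integrableI_bounded) (use F_meas[OF that] F_mass[OF that] in auto)
  have wF: "\<bar>w z * F t z\<bar> \<le> B * \<bar>F t z\<bar>" for z t
    using bound[of z] by (cases "z \<in> A") (auto simp: F_def abs_mult mult_right_mono)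
  have int: "integrable lborel (\<lambda>z. w z * F t z)" if "t > 0" for t
  proof (rule Bochner_Integration.integrable_bound)
    show "integrable lborel (\<lambda>z. B * \<bar>F t z\<bar>)"
      using F_int[OF that] by simp
    show "AE z in lborel. norm (w z * F t z) \<le> norm (B * \<bar>F t z\<bar>)"
      using wF by (intro AE_I2) (metis real_norm_def order_trans abs_ge_self)
  qed (use F_meas[OF that] in measurable)
  thus "\<And>t. t > 0 \<Longrightarrow> integrable lborel (\<lambda>z. w z * (indicator A z * f z t))"
    by (simp add: F_def)
  have "continuous_on {0<..} (\<lambda>t. \<integral>z. w z * F t z \<partial>lborel)"
    unfolding continuous_on_sequentially
  proof (intro allI ballI impI, elim conjE)
    fix x :: "nat \<Rightarrow> real" and a :: real
    assume a: "a \<in> {0<..}" and x: "\<forall>n. x n \<in> {0<..}" and lim: "x \<longlonglongrightarrow> a"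
    have "(\<lambda>n. \<integral>\<^sup>+z. norm (F (x n) z - F a z) \<partial>lborel) \<longlonglongrightarrow> 0"
    proof (rule Scheffe_lemma2)
      show "AE z in lborel. (\<lambda>n. F (x n) z) \<longlonglongrightarrow> F a z"
      proof (rule AE_I2)
        fix z
        show "(\<lambda>n. F (x n) z) \<longlonglongrightarrow> F a z"
        proof (cases "z \<in> A")
          case True
          have "(f z \<circ> x) \<longlonglongrightarrow> f z a"
            using cont[OF True] a x lim unfolding continuous_on_sequentially by blast
          thus ?thesis using True by (simp add: F_def o_def)
        qed (simp add: F_def)
      qed
    qed (use a x F_int F_mass in auto)
    hence L1: "(\<lambda>n. ennreal \<bar>B\<bar> * (\<integral>\<^sup>+z. norm (F (x n) z - F a z) \<partial>lborel)) \<longlonglongrightarrow> ennreal \<bar>B\<bar> * 0"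
      by (intro ennreal_tendsto_cmult) auto
    have "(\<lambda>n. \<integral>\<^sup>+z. norm (w z * F (x n) z - w z * F a z) \<partial>lborel) \<longlonglongrightarrow> 0"
    proof (rule tendsto_sandwich[OF _ _ tendsto_const L1[unfolded mult_zero_right]])
      show "\<forall>\<^sub>F n in sequentially. (\<integral>\<^sup>+z. norm (w z * F (x n) z - w z * F a z) \<partial>lborel)
              \<le> ennreal \<bar>B\<bar> * (\<integral>\<^sup>+z. norm (F (x n) z - F a z) \<partial>lborel)"
      proof (intro always_eventually allI)
        fix n
        have [measurable]: "F (x n) \<in> borel_measurable borel" "F a \<in> borel_measurable borel"
          using a x by auto
        have "norm (w z * F (x n) z - w z * F a z) \<le> \<bar>B\<bar> * norm (F (x n) z - F a z)" for z
        proof (cases "z \<in> A")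
          case True
          hence "\<bar>w z\<bar> \<le> \<bar>B\<bar>" using bound[of z] by linarith
          thus ?thesis by (simp add: abs_mult mult_right_mono flip: right_diff_distrib)
        qed (simp add: F_def)
        hence "(\<integral>\<^sup>+z. norm (w z * F (x n) z - w z * F a z) \<partial>lborel)
            \<le> (\<integral>\<^sup>+z. ennreal \<bar>B\<bar> * norm (F (x n) z - F a z) \<partial>lborel)"
          by (intro nn_integral_mono) (simp flip: ennreal_mult' add: ennreal_leI)
        also have "\<dots> = ennreal \<bar>B\<bar> * (\<integral>\<^sup>+z. norm (F (x n) z - F a z) \<partial>lborel)"
          by (intro nn_integral_cmult) auto
        finally show "(\<integral>\<^sup>+z. norm (w z * F (x n) z - w z * F a z) \<partial>lborel)
              \<le> ennreal \<bar>B\<bar> * (\<integral>\<^sup>+z. norm (F (x n) z - F a z) \<partial>lborel)" .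
      qed
    qed auto
    hence "(\<lambda>n. \<integral>z. w z * F (x n) z \<partial>lborel) \<longlonglongrightarrow> (\<integral>z. w z * F a z \<partial>lborel)"
      by (intro tendsto_L1_int[rotated 2]) (use a x int in auto)
    thus "((\<lambda>t. \<integral>z. w z * F t z \<partial>lborel) \<circ> x) \<longlonglongrightarrow> (\<integral>z. w z * F a z \<partial>lborel)"
      by (simp add: o_def)
  qed
  thus "continuous_on {0<..} (\<lambda>t. \<integral>z. w z * (indicator A z * f z t) \<partial>lborel)"
    by (simp add: F_def)
qed

section \<open>The Laplace transform of the random time\<close>

text \<open>Transforming in both variables turns the given transform in \<open>t\<close>, an exponential in \<open>z\<close>, into an
elementary integral over \<open>z\<close>; nonnegativity allows the exchange of the two integrations.\<close>

lemma double_laplace_time_density: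
  fixes \<nu> s \<mu> :: real and f :: "real \<Rightarrow> real \<Rightarrow> real"
  defines "G \<equiv> \<lambda>t. \<integral>z. exp (- s * z) * (indicator {0<..} z * f z t) \<partial>lborel"
  assumes dens: "fractional_time_density \<nu> f"
    and int: "\<And>t. t > 0 \<Longrightarrow> integrable lborel (\<lambda>z. exp (- s * z) * (indicator {0<..} z * f z t))"
    and cont: "continuous_on {0<..} G"
    and s: "s > 0" and \<mu>: "\<mu> > 0"
  shows "has_bochner_integral lborel (\<lambda>t. indicator {0<..} t * (exp (- \<mu> * t) * G t))
           (\<mu> powr (\<nu> - 1) / (\<mu> powr \<nu> + s))"
proof -
  have nonneg: "f z t \<ge> 0" if "z > 0" "t > 0" for z t
    using dens that by (simp add: fractional_time_density_def)
  have lap: "(LBINT t:{0<..}. exp (- \<mu> * t) * f z t) = \<mu> powr (\<nu> - 1) * exp (- z * \<mu> powr \<nu>)"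
    if "z > 0" for z
    using dens \<mu> that by (simp add: fractional_time_density_def)
  have joint [measurable]:
    "(\<lambda>(z, t). indicator {0<..} z * indicator {0<..} t * f z t) \<in> borel_measurable (borel \<Otimes>\<^sub>M borel)"
    using dens by (intro borel_measurable_caratheodory)
      (auto simp: fractional_time_density_def set_borel_measurable_def)
  define K where "K z t = ennreal (exp (- \<mu> * t) * exp (- s * z) * (indicator {0<..} z * indicator {0<..} t * f z t))"
    for z t
  have K_meas: "(\<lambda>(z, t). K z t) \<in> borel_measurable (lborel \<Otimes>\<^sub>M lborel)"
    unfolding K_def by measurable
  have inner_z: "(\<integral>\<^sup>+z. K z t \<partial>lborel) = ennreal (indicator {0<..} t * (exp (- \<mu> * t) * G t))" for t
  proof (cases "t > 0")
    case True
    have "(\<integral>\<^sup>+z. K z t \<partial>lborel) = (\<integral>\<^sup>+z. ennreal (exp (- \<mu> * t) * (exp (- s * z) * (indicator {0<..} z * f z t))) \<partial>lborel)"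
      using True by (simp add: K_def mult_ac)
    also have "\<dots> = ennreal (\<integral>z. exp (- \<mu> * t) * (exp (- s * z) * (indicator {0<..} z * f z t)) \<partial>lborel)"
      using True int[OF True] nonneg by (intro nn_integral_eq_integral) (auto simp: indicator_def)
    also have "\<dots> = ennreal (exp (- \<mu> * t) * G t)"
      by (simp add: G_def)
    finally show ?thesis using True by simp
  qed (simp add: K_def)
  have inner_t: "(\<integral>\<^sup>+t. K z t \<partial>lborel)
      = ennreal (\<mu> powr (\<nu> - 1)) * ennreal (indicator {0<..} z * (z powr (1 - 1) * exp (- (\<mu> powr \<nu> + s) * z)))" for z
  proof (cases "z > 0")
    case True
    let ?h = "\<lambda>t. indicator {0<..} t * (exp (- \<mu> * t) * f z t)"
    have val: "integral\<^sup>L lborel ?h = \<mu> powr (\<nu> - 1) * exp (- z * \<mu> powr \<nu>)"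
      using lap[OF True] by (simp add: set_lebesgue_integral_def)
    \<comment> \<open>A non-integrable function would have Bochner integral 0, whereas the prescribed value is positive.\<close>
    have h_int: "integrable lborel ?h"
      by (rule ccontr) (use val \<mu> in \<open>simp add: not_integrable_integral_eq\<close>)
    have "(\<integral>\<^sup>+t. K z t \<partial>lborel) = (\<integral>\<^sup>+t. ennreal (exp (- s * z) * ?h t) \<partial>lborel)"
      using True by (simp add: K_def mult_ac)
    also have "\<dots> = ennreal (\<integral>t. exp (- s * z) * ?h t \<partial>lborel)"
      using True h_int nonneg by (intro nn_integral_eq_integral) (auto simp: indicator_def)
    also have "(\<integral>t. exp (- s * z) * ?h t \<partial>lborel) = exp (- s * z) * (\<mu> powr (\<nu> - 1) * exp (- z * \<mu> powr \<nu>))"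
      using val by simp
    also have "\<dots> = \<mu> powr (\<nu> - 1) * exp (- (\<mu> powr \<nu> + s) * z)"
      by (simp add: exp_add[symmetric] algebra_simps)
    finally show ?thesis using True by (simp add: ennreal_mult')
  qed (simp add: K_def)
  have "(\<integral>\<^sup>+t. ennreal (indicator {0<..} t * (exp (- \<mu> * t) * G t)) \<partial>lborel)
      = (\<integral>\<^sup>+t. (\<integral>\<^sup>+z. K z t \<partial>lborel) \<partial>lborel)"
    by (simp only: inner_z)
  also have "\<dots> = (\<integral>\<^sup>+z. (\<integral>\<^sup>+t. K z t \<partial>lborel) \<partial>lborel)"
    by (rule lborel_pair.Fubini'[OF K_meas])
  also have "\<dots> = ennreal (\<mu> powr (\<nu> - 1)) *
      (\<integral>\<^sup>+z. ennreal (indicator {0<..} z * (z powr (1 - 1) * exp (- (\<mu> powr \<nu> + s) * z))) \<partial>lborel)"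
    unfolding inner_t by (intro nn_integral_cmult) auto
  also have "(\<integral>\<^sup>+z. ennreal (indicator {0<..} z * (z powr (1 - 1) * exp (- (\<mu> powr \<nu> + s) * z))) \<partial>lborel)
      = ennreal (Gamma 1 / (\<mu> powr \<nu> + s) powr 1)"
    using has_bochner_integral_powr_exp[of 1 "\<mu> powr \<nu> + s"] s
    by (subst nn_integral_eq_integral) (auto simp: has_bochner_integral_iff add_nonneg_pos)
  also have "ennreal (\<mu> powr (\<nu> - 1)) * \<dots> = ennreal (\<mu> powr (\<nu> - 1) / (\<mu> powr \<nu> + s))"
    using s by (simp add: add_nonneg_pos flip: ennreal_mult')
  finally have nn: "(\<integral>\<^sup>+t. ennreal (indicator {0<..} t * (exp (- \<mu> * t) * G t)) \<partial>lborel)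
      = ennreal (\<mu> powr (\<nu> - 1) / (\<mu> powr \<nu> + s))" .
  show ?thesis
  proof (rule has_bochner_integral_nn_integral[OF _ _ _ nn])
    have "(\<lambda>t. indicator {0<..} t *\<^sub>R (exp (- \<mu> * t) * G t)) \<in> borel_measurable borel"
      by (intro borel_measurable_continuous_on_indicator continuous_intros cont) auto
    thus "(\<lambda>t. indicator {0<..} t * (exp (- \<mu> * t) * G t)) \<in> borel_measurable lborel" by simp
    show "AE t in lborel. 0 \<le> indicator {0<..} t * (exp (- \<mu> * t) * G t)"
      using nonneg unfolding G_def
      by (intro AE_I2) (auto simp: indicator_def intro!: mult_nonneg_nonneg Bochner_Integration.integral_nonneg)
    show "0 \<le> \<mu> powr (\<nu> - 1) / (\<mu> powr \<nu> + s)" using s by simp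
  qed
qed

text \<open>Both sides are continuous in \<open>t\<close> and, for \<open>\<nu> < 1\<close>, have the same Laplace transform
\<open>\<mu> powr (\<nu> - 1) / (\<mu> powr \<nu> + s)\<close> in \<open>t\<close>, so they agree at every single \<open>t\<close>. For \<open>\<nu> = 1\<close> the random time is
deterministic and the Mittag-Leffler function is the exponential.\<close>

lemma laplace_fractional_time_law:
  fixes \<nu> s t :: real
  assumes law: "fractional_time_law \<nu> T" and \<nu>: "\<nu> > 0" and s: "s > 0" and t: "t > 0"
  shows "(LINT z:{0..}|T t. exp (- s * z)) = mittag_leffler \<nu> 1 (- (s * t powr \<nu>))"
proof (cases "\<nu> = 1")
  case True
  hence "T t = return borel t"
    using law t by (simp add: fractional_time_law_def)
  hence "(LINT z:{0..}|T t. exp (- s * z)) = exp (- s * t)"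
    using t by (simp add: set_lebesgue_integral_def integral_return)
  thus ?thesis using True t by (simp add: mittag_leffler_1_1)
next
  case False
  then obtain f where prob: "\<And>t. t > 0 \<Longrightarrow> prob_space (T t)" and dens: "fractional_time_density \<nu> f"
    and T: "\<And>t. t > 0 \<Longrightarrow> T t = density lborel (\<lambda>z. indicator {0<..} z * ennreal (f z t))"
    using law unfolding fractional_time_law_def if_not_P[OF False] by blast
  define G where "G t = (\<integral>z. exp (- s * z) * (indicator {0<..} z * f z t) \<partial>lborel)" for t
  have ind: "indicator {0<..} z * ennreal (f z t) = ennreal (indicator {0<..} z * f z t)" for z t
    by (simp add: indicator_def)
  have nonneg: "f z t \<ge> 0" if "z \<in> {0<..}" "t > 0" for z t
    using dens that by (simp add: fractional_time_density_def)
  have meas: "(\<lambda>z. indicator {0<..} z * f z t) \<in> borel_measurable borel" if "t > 0" for t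
    using dens that by (simp add: fractional_time_density_def set_borel_measurable_def)
  have f_cont: "continuous_on {0<..} (f z)" if "z \<in> {0<..}" for z
    using dens that by (simp add: fractional_time_density_def)
  have mass: "(\<integral>\<^sup>+z. ennreal (indicator {0<..} z * f z t) \<partial>lborel) = 1" if "t > 0" for t
    using prob_space.emeasure_space_1[OF prob[OF that]] meas[OF that]
    by (simp add: T[OF that] ind emeasure_density)
  have bound: "\<bar>exp (- s * z)\<bar> \<le> 1" if "z \<in> {0<..}" for z
    using that s by simp
  have exp_meas: "(\<lambda>z. exp (- s * z)) \<in> borel_measurable borel" by measurable
  note dens_int = integrable_density_integrand[OF nonneg meas f_cont mass exp_meas bound]
  note G_cont = continuous_on_density_integral(2)[OF nonneg meas f_cont mass exp_meas bound, folded G_def]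
  define E where "E t = mittag_leffler \<nu> 1 (- s * t powr \<nu>)" for t
  have E_cont: "continuous_on {0<..} E"
  proof -
    have ml: "continuous_on UNIV (mittag_leffler \<nu> 1)"
      using isCont_mittag_leffler[OF \<nu>] by (simp add: continuous_at_imp_continuous_on)
    show ?thesis unfolding E_def
      by (intro continuous_on_compose2[OF ml] continuous_intros) auto
  qed
  \<comment> \<open>The termwise transform of the Mittag-Leffler series converges only for \<open>s < \<mu> powr \<nu>\<close>, so the comparison
      starts at a \<open>\<mu>\<^sub>0\<close> beyond that abscissa, and the weight \<open>exp (- \<mu>\<^sub>0 * t)\<close> is absorbed into \<open>\<phi>\<close>.\<close>
  define \<mu>\<^sub>0 where "\<mu>\<^sub>0 = (s + 1) powr (1 / \<nu>)"
  have \<mu>\<^sub>0: "\<mu>\<^sub>0 > 0" "\<mu>\<^sub>0 powr \<nu> = s + 1"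
    using s \<nu> by (auto simp: \<mu>\<^sub>0_def powr_powr)
  define \<phi> where "\<phi> t = exp (- \<mu>\<^sub>0 * t) * (G t - E t)" for t
  have vanish: "has_bochner_integral lborel (\<lambda>t. indicator {0<..} t * (exp (- t) ^ n * \<phi> t)) 0" for n :: nat
  proof -
    let ?\<mu> = "\<mu>\<^sub>0 + real n"
    have \<mu>: "?\<mu> > 0" using \<mu>\<^sub>0 by simp
    have "\<mu>\<^sub>0 powr \<nu> \<le> ?\<mu> powr \<nu>" using \<mu>\<^sub>0 \<nu> by (intro powr_mono2) auto
    hence c: "\<bar>- s\<bar> < ?\<mu> powr \<nu>" using \<mu>\<^sub>0 s by simp
    have "has_bochner_integral lborel (\<lambda>t. indicator {0<..} t * (exp (- ?\<mu> * t) * G t)) (?\<mu> powr (\<nu> - 1) / (?\<mu> powr \<nu> + s))"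
      unfolding G_def using G_cont[unfolded G_def] by (intro double_laplace_time_density[OF dens] dens_int s \<mu>)
    moreover have "has_bochner_integral lborel (\<lambda>t. indicator {0<..} t * (exp (- ?\<mu> * t) * E t)) (?\<mu> powr (\<nu> - 1) / (?\<mu> powr \<nu> - - s))"
      unfolding E_def by (rule laplace_mittag_leffler[OF \<nu> \<mu> c])
    ultimately have "has_bochner_integral lborel (\<lambda>t. indicator {0<..} t * (exp (- ?\<mu> * t) * G t) - indicator {0<..} t * (exp (- ?\<mu> * t) * E t))
        (?\<mu> powr (\<nu> - 1) / (?\<mu> powr \<nu> + s) - ?\<mu> powr (\<nu> - 1) / (?\<mu> powr \<nu> - - s))"
      by (rule has_bochner_integral_diff)
    moreover have "indicator {0<..} t * (exp (- ?\<mu> * t) * G t) - indicator {0<..} t * (exp (- ?\<mu> * t) * E t)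
        = indicator {0<..} t * (exp (- t) ^ n * \<phi> t)" for t
    proof -
      have "exp (- ?\<mu> * t) = exp (- t) ^ n * exp (- \<mu>\<^sub>0 * t)"
        by (simp add: exp_of_nat_mult[symmetric] exp_add[symmetric] algebra_simps)
      thus ?thesis by (simp add: \<phi>_def algebra_simps)
    qed
    ultimately show ?thesis by simp
  qed
  have "\<phi> t = 0"
  proof (rule laplace_zero_imp_zero[OF _ _ _ t])
    show "continuous_on {0<..} \<phi>"
      unfolding \<phi>_def by (intro continuous_intros G_cont E_cont)
    show "set_integrable lborel {0<..} \<phi>"
      using vanish[of 0] by (simp add: set_integrable_def has_bochner_integral_iff)
    show "(LBINT t:{0<..}. exp (- t) ^ n * \<phi> t) = 0" for n :: nat
      using vanish[of n] by (simp add: set_lebesgue_integral_def has_bochner_integral_iff)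
  qed
  hence "G t = E t" by (simp add: \<phi>_def)
  moreover have "(LINT z:{0..}|T t. exp (- s * z)) = G t"
  proof -
    have "(LINT z:{0..}|T t. exp (- s * z))
        = (\<integral>z. (indicator {0<..} z * f z t) *\<^sub>R (indicator {0..} z *\<^sub>R exp (- s * z)) \<partial>lborel)"
      unfolding set_lebesgue_integral_def T[OF t] ind
      by (rule integral_density) (use meas[OF t] nonneg t in \<open>auto simp: indicator_def\<close>)
    also have "\<dots> = G t"
      unfolding G_def by (intro Bochner_Integration.integral_cong) (auto simp: indicator_def)
    finally show ?thesis .
  qed
  ultimately show ?thesis by (simp add: E_def)
qed

section \<open>The state probabilities\<close>

lemma fractional_time_law_finite:
  assumes law: "fractional_time_law \<nu> T" and t: "t > 0"
  shows "finite_measure (T t)" and "sets (T t) = sets borel"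
proof -
  have "finite_measure (T t) \<and> sets (T t) = sets borel"
  proof (cases "\<nu> = 1")
    case True
    hence "T t = return borel t"
      using law t by (simp add: fractional_time_law_def)
    thus ?thesis
      using prob_space.finite_measure[OF prob_space_return[of t borel]] by simp
  next
    case False
    thus ?thesis
      using law t unfolding fractional_time_law_def if_not_P[OF False]
      by (auto intro: prob_space.finite_measure)
  qed
  thus "finite_measure (T t)" "sets (T t) = sets borel" by auto
qed

lemma yule_mixture_mittag_leffler:
  fixes \<nu> lam t :: real and n0 k :: nat
  assumes law: "fractional_time_law \<nu> T" and \<nu>: "\<nu> > 0" and lam: "lam > 0" and n0: "n0 \<ge> 1"
    and t: "t > 0"
  shows "(LINT z:{0..}|T t. exp (- lam * z * real n0) * (1 - exp (- lam * z)) ^ k)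
       = (\<Sum>r=0..k. real (k choose r) * (- 1) ^ r *
            mittag_leffler \<nu> 1 (- (real (n0 + r) * lam * t powr \<nu>)))"
proof -
  interpret finite_measure "T t" by (rule fractional_time_law_finite[OF law t])
  have sets [measurable_cong]: "sets (T t) = sets borel"
    by (rule fractional_time_law_finite[OF law t])
  have expand: "exp (- lam * z * real n0) * (1 - exp (- lam * z)) ^ k
      = (\<Sum>r=0..k. real (k choose r) * (- 1) ^ r * exp (- (real (n0 + r) * lam) * z))" for z
  proof -
    have "(1 - exp (- lam * z)) ^ k = (- exp (- lam * z) + 1) ^ k" by simp
    also have "\<dots> = (\<Sum>r\<le>k. real (k choose r) * (- exp (- lam * z)) ^ r * 1 ^ (k - r))"
      by (rule binomial_ring)
    also have "\<dots> = (\<Sum>r=0..k. real (k choose r) * (- 1) ^ r * exp (- (real r * lam) * z))"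
      by (intro sum.cong) (auto simp: power_minus[of "exp _"] exp_of_nat_mult[symmetric] mult_ac)
    finally show ?thesis
      by (simp add: sum_distrib_left algebra_simps flip: exp_add)
  qed
  have int: "set_integrable (T t) {0..} (\<lambda>z. exp (- s * z))" if "s > 0" for s :: real
    unfolding set_integrable_def
    by (rule integrable_const_bound[of _ 1]) (use that in \<open>auto simp: indicator_def\<close>)
  have "(LINT z:{0..}|T t. exp (- lam * z * real n0) * (1 - exp (- lam * z)) ^ k)
      = (\<Sum>r=0..k. LINT z:{0..}|T t. real (k choose r) * (- 1) ^ r * exp (- (real (n0 + r) * lam) * z))"
  proof -
    have "set_integrable (T t) {0..} (\<lambda>z. real (k choose r) * (- 1) ^ r * exp (- (real (n0 + r) * lam) * z))" for r
      using lam n0 by (intro set_integrable_mult_right int) auto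
    thus ?thesis
      unfolding expand set_lebesgue_integral_def set_integrable_def scaleR_sum_right
      by (rule Bochner_Integration.integral_sum)
  qed
  also have "\<dots> = (\<Sum>r=0..k. real (k choose r) * (- 1) ^ r *
            mittag_leffler \<nu> 1 (- (real (n0 + r) * lam * t powr \<nu>)))"
    using lam n0 t by (simp only: set_integral_mult_right)
      (intro sum.cong refl arg_cong2[of _ _ _ _ "(*)"], subst laplace_fractional_time_law[OF law \<nu> _ t], auto)
  finally show ?thesis .
qed

text \<open>In the variable \<open>y = t powr \<nu>\<close>, which tends to 0 with \<open>t\<close>, this is the first-order expansion at 0: the
constant terms cancel, and the derivative there is the reciprocal of \<open>Gamma (\<nu> + 1)\<close>.\<close>

lemma mittag_leffler_difference_asymp:
  fixes \<nu> a b :: real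
  assumes \<nu>: "\<nu> > 0" and ab: "a \<noteq> b"
  shows "(\<lambda>t. mittag_leffler \<nu> 1 (a * t powr \<nu>) - mittag_leffler \<nu> 1 (b * t powr \<nu>))
           \<sim>[at_right 0] (\<lambda>t. (a - b) * t powr \<nu> / Gamma (\<nu> + 1))"
proof -
  define D where "D y = mittag_leffler \<nu> 1 (a * y) - mittag_leffler \<nu> 1 (b * y)" for y
  have G: "Gamma (\<nu> + 1) > 0" using \<nu> by (intro Gamma_real_pos) auto
  have E: "((\<lambda>y. mittag_leffler \<nu> 1 (c * y)) has_real_derivative 1 / Gamma (\<nu> + 1) * c) (at 0)" for c
    by (rule DERIV_chain2[where g = "\<lambda>y. c * y"])
      (use mittag_leffler_deriv_0[OF \<nu>] in \<open>auto intro!: derivative_eq_intros\<close>)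
  have "(D has_real_derivative (1 / Gamma (\<nu> + 1)) * a - (1 / Gamma (\<nu> + 1)) * b) (at 0)"
    unfolding D_def
    by (intro DERIV_diff E)
  hence "((\<lambda>y. D y / y) \<longlongrightarrow> (1 / Gamma (\<nu> + 1)) * a - (1 / Gamma (\<nu> + 1)) * b) (at 0)"
    by (simp add: has_field_derivative_iff D_def)
  moreover have "filterlim (\<lambda>t. t powr \<nu>) (at 0) (at_right (0::real))"
    unfolding filterlim_at
  proof
    show "\<forall>\<^sub>F t in at_right 0. t powr \<nu> \<in> UNIV \<and> t powr \<nu> \<noteq> (0::real)"
      using eventually_at_right_less[of "0::real"] by eventually_elim auto
    show "((\<lambda>t. t powr \<nu>) \<longlongrightarrow> 0) (at_right (0::real))"
      using eventually_at_right_less[of "0::real"] \<nu>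
      by (intro tendsto_zero_powrI[OF tendsto_ident_at tendsto_const]) (auto elim: eventually_mono)
  qed
  ultimately have "((\<lambda>t. D (t powr \<nu>) / t powr \<nu>) \<longlongrightarrow> (1 / Gamma (\<nu> + 1)) * a - (1 / Gamma (\<nu> + 1)) * b) (at_right 0)"
    by (rule filterlim_compose)
  hence "((\<lambda>t. (D (t powr \<nu>) / t powr \<nu>) * (Gamma (\<nu> + 1) / (a - b)))
           \<longlongrightarrow> ((1 / Gamma (\<nu> + 1)) * a - (1 / Gamma (\<nu> + 1)) * b) * (Gamma (\<nu> + 1) / (a - b))) (at_right 0)"
    by (rule tendsto_mult_right)
  moreover have "((1 / Gamma (\<nu> + 1)) * a - (1 / Gamma (\<nu> + 1)) * b) * (Gamma (\<nu> + 1) / (a - b)) = 1"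
    using ab G by (simp add: divide_simps)
  moreover have "(D y / y) * (Gamma (\<nu> + 1) / (a - b)) = D y / ((a - b) * y / Gamma (\<nu> + 1))" for y
    by simp
  ultimately have "((\<lambda>t. D (t powr \<nu>) / ((a - b) * t powr \<nu> / Gamma (\<nu> + 1))) \<longlongrightarrow> 1) (at_right 0)"
    by (simp only:)
  hence "(\<lambda>t. D (t powr \<nu>)) \<sim>[at_right 0] (\<lambda>t. (a - b) * t powr \<nu> / Gamma (\<nu> + 1))"
    by (rule asymp_equivI')
  thus ?thesis by (simp add: D_def)
qed

theorem mainTheorem8:
  fixes \<nu> lam :: real and n0 :: nat and M :: "'a measure" and N :: "real \<Rightarrow> 'a \<Rightarrow> nat"
  assumes "0 < \<nu>" and "\<nu> \<le> 1" and "lam > 0" and "n0 \<ge> 1"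
    and "fractional_linear_birth_process \<nu> lam n0 M N"
  shows "(\<forall>t>0. \<forall>k.
            \<P>(\<omega> in M. N t \<omega> = k + n0 \<bar> N 0 \<omega> = n0) =
              real ((n0 + k - 1) choose k) *
              (\<Sum>r=0..k. real (k choose r) * (- 1) ^ r *
                 mittag_leffler \<nu> 1 (- (real (n0 + r) * lam * t powr \<nu>))))
       \<and> (\<lambda>t. \<P>(\<omega> in M. N t \<omega> = n0 + 1 \<bar> N 0 \<omega> = n0))
           \<sim>[at_right 0] (\<lambda>t. lam * real n0 * t powr \<nu> / Gamma (\<nu> + 1))"
proof
  obtain T where law: "fractional_time_law \<nu> T"
    and N: "\<And>t k. t > 0 \<Longrightarrow> \<P>(\<omega> in M. N t \<omega> = k + n0 \<bar> N 0 \<omega> = n0) =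
             real ((n0 + k - 1) choose k) *
             (LINT z:{0..}|T t. exp (- lam * z * real n0) * (1 - exp (- lam * z)) ^ k)"
    using assms(5) unfolding fractional_linear_birth_process_def by blast
  show formula: "\<forall>t>0. \<forall>k.
            \<P>(\<omega> in M. N t \<omega> = k + n0 \<bar> N 0 \<omega> = n0) =
              real ((n0 + k - 1) choose k) *
              (\<Sum>r=0..k. real (k choose r) * (- 1) ^ r *
                 mittag_leffler \<nu> 1 (- (real (n0 + r) * lam * t powr \<nu>)))"
    using N yule_mixture_mittag_leffler[OF law assms(1,3,4)] by simp
  let ?a = "- (real n0 * lam)" and ?b = "- (real (n0 + 1) * lam)"
  have "(\<lambda>t. real n0 * (mittag_leffler \<nu> 1 (?a * t powr \<nu>) - mittag_leffler \<nu> 1 (?b * t powr \<nu>)))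
      \<sim>[at_right 0] (\<lambda>t. real n0 * ((?a - ?b) * t powr \<nu> / Gamma (\<nu> + 1)))"
    using assms by (intro asymp_equiv_intros mittag_leffler_difference_asymp) (auto simp: algebra_simps)
  also have "(\<lambda>t. real n0 * ((?a - ?b) * t powr \<nu> / Gamma (\<nu> + 1)))
      = (\<lambda>t. lam * real n0 * t powr \<nu> / Gamma (\<nu> + 1))"
    by (simp add: algebra_simps)
  finally have asymp: "(\<lambda>t. real n0 * (mittag_leffler \<nu> 1 (?a * t powr \<nu>) - mittag_leffler \<nu> 1 (?b * t powr \<nu>)))
      \<sim>[at_right 0] (\<lambda>t. lam * real n0 * t powr \<nu> / Gamma (\<nu> + 1))" .
  have "\<forall>\<^sub>F t in at_right 0. real n0 * (mittag_leffler \<nu> 1 (?a * t powr \<nu>) - mittag_leffler \<nu> 1 (?b * t powr \<nu>))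
      = \<P>(\<omega> in M. N t \<omega> = n0 + 1 \<bar> N 0 \<omega> = n0)"
    using eventually_at_right_less[of "0::real"]
  proof eventually_elim
    case (elim t)
    show ?case using formula[rule_format, OF elim, of 1] by (simp add: add.commute)
  qed
  from asymp_equiv_cong[THEN iffD1, OF this _ asymp]
  show "(\<lambda>t. \<P>(\<omega> in M. N t \<omega> = n0 + 1 \<bar> N 0 \<omega> = n0))
           \<sim>[at_right 0] (\<lambda>t. lam * real n0 * t powr \<nu> / Gamma (\<nu> + 1))"
    by simp
qed

end
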